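(* Let $\mathcal{R}$ be a finite valuation ring of order $q^r$. For any $X_1,X_2\subseteq\mathcal{R}^*$ with \[|X_1||X_2|>\frac{q^{4r-1}}{(q^r-q^{r-1})^2},\] there exist $x,y\in\mathcal{R}^*$ such that $x+y\in X_1$ and $x\cdot y\in X_2$.
   Context: $\mathcal{R}$ is a finite valuation ring: a finite commutative local ring with identity whose ideals are totally ordered by inclusion (a finite chain ring); its residue field has $q$ elements, $q$ an odd prime power, and $|\mathcal{R}|=q^r$. $\mathcal{R}^*$ denotes the set of units of $\mathcal{R}$. *)

theory Defs
  imports Complex_Main "HOL-Algebra.QuotRing" "HOL-Number_Theory.Prime_Powers"
begin

locale local_cring = cring R for R (structure) +
  assumes unique_maximal_ideal: "\<exists>!M. maximalideal M R"

definition max_ideal :: "('a, 'b) ring_scheme \<Rightarrow> 'a set"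
  where "max_ideal R = (THE M. maximalideal M R)"

definition residue_field :: "('a, 'b) ring_scheme \<Rightarrow> 'a set ring"
  where "residue_field R = R Quot (max_ideal R)"

locale finite_valuation_ring = local_cring R for R (structure) +
  assumes finite_carrier: "finite (carrier R)"
    and ideals_total: "\<And>I J. ideal I R \<Longrightarrow> ideal J R \<Longrightarrow> I \<subseteq> J \<or> J \<subseteq> I"

end

theory Submission
  imports Defs "HOL-Algebra.Polynomial_Divisibility" "HOL-Algebra.Multiplicative_Group"
begin

text \<open>
  Since $2$ is a unit, $x + y = a$ and $xy = b$ is solvable as soon as $a^2 - 4b$ is a square.
  So if the conclusion fails, all differences between $Y = \{a^2 : a \in X_1\}$ and
  $Z = \{4b : b \in X_2\}$ are nonsquares, and $|X_1| \le 2 |Y|$. Unit squares lift from the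
  residue field $K$, so distinct residues of $Y$ and $Z$ differ by nonsquares of $K$.

  Over $K$, with $q = 2d + 1$, Stepanov's method in the style of Hanson and Petridis shows
  $|U| |V| \le d$ when $U$ consists of nonzero squares and $u - v$ is never a square: put
  $m = |U|$, choose weights $c_u$ with $\sum c_u (y - u)^k = [k = m - 1]$ for $k < m$, and consider
  $g(x) = \sum c_u (x - u)^{d + m - 1} - e$, where $e$ is the common value of $(v - u)^d$.
  It has degree at most $d$ and vanishes to order $m$ on $V$. It is not the zero polynomial,
  because $(0 - u)^d = -e$ for squares $u$ gives $g(0) = -2e$; this evaluation replaces the
  nonvanishing of a binomial coefficient and works in every odd characteristic.

  Residues common to $Y$ and $Z$ cost little: above such a residue the two sets are disjoint, and
  splitting the common residues in all possible ratios gives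
  $|Y| |Z| \le |\mathfrak{m}|^2 (d + 1/4)$, hence $|X_1| |X_2| < |\mathfrak{m}|^2 q$.
\<close>

section \<open>Stepanov bound over a field\<close>

text \<open>The extra factors $(y - u)^j$ close these polynomials under the recursion coming from
  $X - u = (X - y) + (y - u)$, which replaces explicit Taylor expansion at $y$.\<close>
definition (in ring) power_comb :: "('a \<Rightarrow> 'a) \<Rightarrow> 'a set \<Rightarrow> 'a \<Rightarrow> nat \<Rightarrow> nat \<Rightarrow> 'a list"
  where "power_comb c U y j n =
    (\<Oplus>\<^bsub>poly_ring R\<^esub>u\<in>U. poly_of_const (c u \<otimes> (y \<ominus> u) [^] j) \<otimes>\<^bsub>poly_ring R\<^esub> [\<one>, \<ominus> u] [^]\<^bsub>poly_ring R\<^esub> n)"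

text \<open>Inductive step for orders of vanishing: the explicit factor \<open>l\<close> supplies
  the power that \<open>a\<close> lacks, so in a recursion \<open>l \<otimes> a \<oplus> b\<close>
  the order required of \<open>a\<close> is one lower.\<close>

lemma (in cring) pow_Suc_divides_combination:
  assumes "l \<in> carrier R" "a \<in> carrier R" "b \<in> carrier R"
    and "l [^] m divides a" and "l [^] Suc m divides b"
  shows "l [^] Suc m divides (l \<otimes> a \<oplus> b)"
proof -
  obtain s t where s: "s \<in> carrier R" "a = l [^] m \<otimes> s" and t: "t \<in> carrier R" "b = l [^] Suc m \<otimes> t"
    using assms(4,5) by (auto simp: factor_def)
  have "l [^] m \<in> carrier R" using assms(1) by simp
  then have "l \<otimes> a \<oplus> b = l [^] Suc m \<otimes> (s \<oplus> t)"
    unfolding s t nat_pow_Suc using assms(1) s(1) t(1) by algebra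
  then show ?thesis using s t by (auto simp: factor_def)
qed

section \<open>Weights and weighted sums of powers of linear polynomials\<close>

context field
begin

text \<open>These are divided difference weights: \<open>c u\<close> is the inverse of the product
  of u' - u over the other elements u' of \<open>U\<close>. They do not depend on \<open>y\<close>,
  so a single polynomial can be expanded at every point.\<close>

lemma exists_power_sum_weights:
  assumes "finite U" "U \<noteq> {}" "U \<subseteq> carrier R"
  shows "\<exists>c \<in> U \<rightarrow> carrier R. \<forall>y\<in>carrier R. \<forall>k<card U.
           (\<Oplus>u\<in>U. c u \<otimes> (y \<ominus> u) [^] k) = (if Suc k = card U then \<one> else \<zero>)"
  using assms
proof (induction U rule: finite_ne_induct)
  case (singleton x)
  then show ?case by (intro bexI[of _ "\<lambda>_. \<one>"]) auto
next
  case (insert w W)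
  then obtain c where c: "c \<in> W \<rightarrow> carrier R"
    and IH: "\<And>y k. y \<in> carrier R \<Longrightarrow> k < card W \<Longrightarrow>
      (\<Oplus>u\<in>W. c u \<otimes> (y \<ominus> u) [^] k) = (if Suc k = card W then \<one> else \<zero>)"
    by auto
  have W: "\<And>u. u \<in> W \<Longrightarrow> u \<in> carrier R" and w: "w \<in> carrier R" using insert.prems by auto
  define b where "b u = c u \<otimes> inv (w \<ominus> u)" for u
  have wu: "w \<ominus> u \<in> Units R" if "u \<in> W" for u
    using that W w insert.hyps by (auto simp: field_Units)
  have b: "b u \<in> carrier R" if "u \<in> W" for u
    using that c wu by (auto simp: b_def)
  \<comment> \<open>The weight at \<open>w\<close> is chosen to make the sum for exponent 0
    vanish.\<close>
  define e where "e u = (if u = w then \<ominus> (\<Oplus>x\<in>W. b x) else b u)" for u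
  have e_W: "e u = b u" if "u \<in> W" for u using that insert.hyps by (auto simp: e_def)
  have e_w: "e w = \<ominus> (\<Oplus>x\<in>W. b x)" by (simp add: e_def)
  have e: "e u \<in> carrier R" if "u \<in> insert w W" for u
    using that b by (auto simp: e_def)
  \<comment> \<open>The extra factor \<open>w \<ominus> u\<close> kills the new term and cancels the
    inverse in \<open>b u\<close>, which leads back to the weights of \<open>W\<close>.\<close>
  have sum_W: "(\<Oplus>u\<in>insert w W. e u \<otimes> ((w \<ominus> u) \<otimes> (y \<ominus> u) [^] k)) = (\<Oplus>u\<in>W. c u \<otimes> (y \<ominus> u) [^] k)"
    if y: "y \<in> carrier R" for y and k :: nat
  proof -
    have "(\<Oplus>u\<in>insert w W. e u \<otimes> ((w \<ominus> u) \<otimes> (y \<ominus> u) [^] k))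
        = e w \<otimes> ((w \<ominus> w) \<otimes> (y \<ominus> w) [^] k) \<oplus> (\<Oplus>u\<in>W. e u \<otimes> ((w \<ominus> u) \<otimes> (y \<ominus> u) [^] k))"
      using insert.hyps e W w y by (intro finsum_insert) auto
    also have "e w \<otimes> ((w \<ominus> w) \<otimes> (y \<ominus> w) [^] k) = \<zero>"
      using w y e by (simp add: r_neg a_minus_def)
    also have "(\<Oplus>u\<in>W. e u \<otimes> ((w \<ominus> u) \<otimes> (y \<ominus> u) [^] k)) = (\<Oplus>u\<in>W. c u \<otimes> (y \<ominus> u) [^] k)"
    proof (rule finsum_cong')
      show "e u \<otimes> ((w \<ominus> u) \<otimes> (y \<ominus> u) [^] k) = c u \<otimes> (y \<ominus> u) [^] k" if u: "u \<in> W" for u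
      proof -
        have cu: "c u \<in> carrier R" "w \<ominus> u \<in> carrier R" "inv (w \<ominus> u) \<in> carrier R" "(y \<ominus> u) [^] k \<in> carrier R"
          using c u wu y W w by auto
        have "b u \<otimes> ((w \<ominus> u) \<otimes> (y \<ominus> u) [^] k) = c u \<otimes> (inv (w \<ominus> u) \<otimes> (w \<ominus> u)) \<otimes> (y \<ominus> u) [^] k"
          using cu by (simp add: b_def m_assoc)
        then show ?thesis using e_W[OF u] cu wu[OF u] by simp
      qed
    qed (use c W y in auto)
    finally show ?thesis using c W y by (simp add: Pi_iff)
  qed
  have "(\<Oplus>u\<in>insert w W. e u \<otimes> (y \<ominus> u) [^] k) = (if Suc k = card (insert w W) then \<one> else \<zero>)"
    if y: "y \<in> carrier R" and k: "k < card (insert w W)" for y k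
    using k
  proof (induction k)
    case 0
    have "(\<Oplus>u\<in>insert w W. e u \<otimes> (y \<ominus> u) [^] (0::nat)) = (\<Oplus>u\<in>insert w W. e u)"
      using e W w y by (intro finsum_cong') auto
    also have "\<dots> = e w \<oplus> (\<Oplus>u\<in>W. e u)"
      using insert.hyps e by (intro finsum_insert) auto
    also have "(\<Oplus>u\<in>W. e u) = (\<Oplus>u\<in>W. b u)"
      using b e_W by (intro finsum_cong') auto
    also have "e w \<oplus> (\<Oplus>u\<in>W. b u) = \<zero>"
      using b by (simp add: e_w l_neg)
    finally show ?case using insert.hyps by (auto simp: card_gt_0_iff)
  next
    case (Suc k)
    \<comment> \<open>Split one factor as (y - w) + (w - u). The first part vanishes by induction on
      \<open>k\<close>, since \<open>Suc k\<close> is still below the new cardinality; the second is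
      a sum over \<open>W\<close>.\<close>
    have "(\<Oplus>u\<in>insert w W. e u \<otimes> (y \<ominus> u) [^] Suc k)
        = (\<Oplus>u\<in>insert w W. (y \<ominus> w) \<otimes> (e u \<otimes> (y \<ominus> u) [^] k) \<oplus> e u \<otimes> ((w \<ominus> u) \<otimes> (y \<ominus> u) [^] k))"
    proof (rule finsum_cong')
      fix u assume u: "u \<in> insert w W"
      have cc: "e u \<in> carrier R" "u \<in> carrier R" "(y \<ominus> u) [^] k \<in> carrier R" using e W w y u by auto
      have "y \<ominus> u = (y \<ominus> w) \<oplus> (w \<ominus> u)" using cc w y by algebra
      then have "(y \<ominus> u) [^] Suc k = (y \<ominus> u) [^] k \<otimes> ((y \<ominus> w) \<oplus> (w \<ominus> u))" by simp
      then show "e u \<otimes> (y \<ominus> u) [^] Suc k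
          = (y \<ominus> w) \<otimes> (e u \<otimes> (y \<ominus> u) [^] k) \<oplus> e u \<otimes> ((w \<ominus> u) \<otimes> (y \<ominus> u) [^] k)"
        using cc w y by algebra
    qed (use e W w y in auto)
    also have "\<dots> = (y \<ominus> w) \<otimes> (\<Oplus>u\<in>insert w W. e u \<otimes> (y \<ominus> u) [^] k) \<oplus> (\<Oplus>u\<in>W. c u \<otimes> (y \<ominus> u) [^] k)"
      unfolding sum_W[OF y, symmetric] using insert.hyps e W w y
      by (subst finsum_addf, force, force, subst finsum_rdistr) auto
    also have "\<dots> = (if Suc k = card W then \<one> else \<zero>)"
      using Suc insert.hyps y w IH[OF y] by auto
    finally show ?case using insert.hyps by simp
  qed
  then show ?case using e by (intro bexI[of _ e]) auto
qed

interpretation P: domain "poly_ring R"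
  using univ_poly_is_domain[OF carrier_is_subring] .

interpretation C: ring_hom_cring R "poly_ring R" poly_of_const
  using canonical_embedding_is_hom[OF carrier_is_subring]
  by (intro ring_hom_cring.intro ring_hom_cring_axioms.intro is_cring P.is_cring) simp

lemma linear_in_carrier: "u \<in> carrier R \<Longrightarrow> [\<one>, \<ominus> u] \<in> carrier (poly_ring R)"
  by (simp add: univ_poly_def polynomial_def)

lemma linear_shift:
  assumes "u \<in> carrier R" "y \<in> carrier R"
  shows "[\<one>, \<ominus> u] = [\<one>, \<ominus> y] \<oplus>\<^bsub>poly_ring R\<^esub> poly_of_const (y \<ominus> u)"
\<comment> \<open>The constant polynomial of zero is the empty list, so this case has a different
  list form.\<close>
proof (cases "y = u")
  case True
  then show ?thesis using assms linear_in_carrier by (simp add: r_neg a_minus_def)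
next
  case False
  moreover have "\<ominus> y \<oplus> (y \<ominus> u) = \<ominus> u" using assms by algebra
  ultimately show ?thesis using assms by (simp add: univ_poly_add poly_of_const_def)
qed

context
  fixes c :: "'a \<Rightarrow> 'a" and U :: "'a set" and y :: 'a
  assumes finU: "finite U" and U: "U \<subseteq> carrier R" and c: "c \<in> U \<rightarrow> carrier R" and y: "y \<in> carrier R"
begin

lemma power_comb_term_closed:
  assumes "u \<in> U"
  shows "c u \<otimes> (y \<ominus> u) [^] (j::nat) \<in> carrier R"
    and "poly_of_const (c u \<otimes> (y \<ominus> u) [^] (j::nat)) \<otimes>\<^bsub>poly_ring R\<^esub> [\<one>, \<ominus> u] [^]\<^bsub>poly_ring R\<^esub> (n::nat)
      \<in> carrier (poly_ring R)"
proof -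
  have "u \<in> carrier R" "c u \<in> carrier R" using assms U c by auto
  then show *: "c u \<otimes> (y \<ominus> u) [^] j \<in> carrier R" using y by simp
  from \<open>u \<in> carrier R\<close> have "[\<one>, \<ominus> u] [^]\<^bsub>poly_ring R\<^esub> n \<in> carrier (poly_ring R)"
    by (intro P.nat_pow_closed linear_in_carrier)
  with * show "poly_of_const (c u \<otimes> (y \<ominus> u) [^] j) \<otimes>\<^bsub>poly_ring R\<^esub> [\<one>, \<ominus> u] [^]\<^bsub>poly_ring R\<^esub> n
      \<in> carrier (poly_ring R)" by simp
qed

lemma power_comb_closed: "power_comb c U y j n \<in> carrier (poly_ring R)"
  unfolding power_comb_def using power_comb_term_closed(2) by (intro P.finsum_closed) auto

lemma power_comb_0: "power_comb c U y j 0 = poly_of_const (\<Oplus>u\<in>U. c u \<otimes> (y \<ominus> u) [^] j)"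
proof -
  have "power_comb c U y j 0 = (\<Oplus>\<^bsub>poly_ring R\<^esub>u\<in>U. poly_of_const (c u \<otimes> (y \<ominus> u) [^] j))"
    unfolding power_comb_def
    by (rule P.finsum_cong') (use power_comb_term_closed(1) in auto)
  then show ?thesis
    using power_comb_term_closed(1) by (subst C.hom_finsum) (auto simp: o_def)
qed

lemma power_comb_Suc:
  "power_comb c U y j (Suc n) =
     [\<one>, \<ominus> y] \<otimes>\<^bsub>poly_ring R\<^esub> power_comb c U y j n \<oplus>\<^bsub>poly_ring R\<^esub> power_comb c U y (Suc j) n"
proof -
  let ?f = "\<lambda>(j::nat) (n::nat) u. poly_of_const (c u \<otimes> (y \<ominus> u) [^] j) \<otimes>\<^bsub>poly_ring R\<^esub> [\<one>, \<ominus> u] [^]\<^bsub>poly_ring R\<^esub> n"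
  note f = power_comb_term_closed(2)
  have "power_comb c U y j (Suc n) =
      (\<Oplus>\<^bsub>poly_ring R\<^esub>u\<in>U. [\<one>, \<ominus> y] \<otimes>\<^bsub>poly_ring R\<^esub> ?f j n u \<oplus>\<^bsub>poly_ring R\<^esub> ?f (Suc j) n u)"
    unfolding power_comb_def
  proof (rule P.finsum_cong')
    fix u assume u: "u \<in> U"
    have cc: "u \<in> carrier R" "c u \<in> carrier R" "y \<ominus> u \<in> carrier R" "(y \<ominus> u) [^] j \<in> carrier R" using u U c y by auto
    define a l p m where "a = poly_of_const (c u \<otimes> (y \<ominus> u) [^] j)" and "l = [\<one>, \<ominus> y]"
      and "p = [\<one>, \<ominus> u] [^]\<^bsub>poly_ring R\<^esub> n" and "m = poly_of_const (y \<ominus> u)"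
    have in_P: "a \<in> carrier (poly_ring R)" "l \<in> carrier (poly_ring R)" "p \<in> carrier (poly_ring R)" "m \<in> carrier (poly_ring R)"
      using cc y by (auto simp: a_def l_def p_def m_def intro!: P.nat_pow_closed linear_in_carrier)
    have 1: "?f j (Suc n) u = a \<otimes>\<^bsub>poly_ring R\<^esub> (p \<otimes>\<^bsub>poly_ring R\<^esub> (l \<oplus>\<^bsub>poly_ring R\<^esub> m))"
      using linear_shift[OF cc(1) y] by (simp add: a_def p_def l_def m_def)
    have 2: "?f (Suc j) n u = (a \<otimes>\<^bsub>poly_ring R\<^esub> m) \<otimes>\<^bsub>poly_ring R\<^esub> p"
      using cc by (simp add: a_def p_def m_def m_assoc flip: C.hom_mult)
    have 3: "a \<otimes>\<^bsub>poly_ring R\<^esub> (p \<otimes>\<^bsub>poly_ring R\<^esub> (l \<oplus>\<^bsub>poly_ring R\<^esub> m))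
        = l \<otimes>\<^bsub>poly_ring R\<^esub> (a \<otimes>\<^bsub>poly_ring R\<^esub> p) \<oplus>\<^bsub>poly_ring R\<^esub> (a \<otimes>\<^bsub>poly_ring R\<^esub> m) \<otimes>\<^bsub>poly_ring R\<^esub> p"
      using in_P by algebra
    have "?f j (Suc n) u = l \<otimes>\<^bsub>poly_ring R\<^esub> (a \<otimes>\<^bsub>poly_ring R\<^esub> p) \<oplus>\<^bsub>poly_ring R\<^esub> ?f (Suc j) n u"
      by (simp only: 1 2 3)
    then show "?f j (Suc n) u = [\<one>, \<ominus> y] \<otimes>\<^bsub>poly_ring R\<^esub> ?f j n u \<oplus>\<^bsub>poly_ring R\<^esub> ?f (Suc j) n u"
      by (simp only: l_def a_def p_def)
  qed (intro refl Pi_I P.a_closed P.m_closed[OF linear_in_carrier[OF y]] f; assumption)+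
  also have "\<dots> = [\<one>, \<ominus> y] \<otimes>\<^bsub>poly_ring R\<^esub> power_comb c U y j n \<oplus>\<^bsub>poly_ring R\<^esub> power_comb c U y (Suc j) n"
  proof -
    have F: "?f i n \<in> U \<rightarrow> carrier (poly_ring R)" for i by (intro Pi_I f)
    have "(\<lambda>u. [\<one>, \<ominus> y] \<otimes>\<^bsub>poly_ring R\<^esub> ?f j n u) \<in> U \<rightarrow> carrier (poly_ring R)"
      by (intro Pi_I P.m_closed[OF linear_in_carrier[OF y]] f)
    then show ?thesis
      unfolding power_comb_def
      by (simp only: P.finsum_addf[OF _ F] P.finsum_rdistr[OF finU linear_in_carrier[OF y] F])
  qed
  finally show ?thesis .
qed

text \<open>By the binomial theorem the coefficient of (X - y)^k is binom(n,k) times the sum in the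
  hypothesis, so all terms of order below \<open>m\<close> vanish. The induction on \<open>n\<close>
  follows the recursion \<open>power_comb_Suc\<close> and never names the binomials.\<close>

lemma linear_pow_divides_power_comb:
  assumes "\<And>k. k < m \<Longrightarrow> k \<le> n \<Longrightarrow> (\<Oplus>u\<in>U. c u \<otimes> (y \<ominus> u) [^] (j + n - k)) = \<zero>"
  shows "[\<one>, \<ominus> y] [^]\<^bsub>poly_ring R\<^esub> m divides\<^bsub>poly_ring R\<^esub> power_comb c U y j n"
  using assms
proof (induction n arbitrary: j m)
  case 0
  show ?case
  proof (cases m)
    case 0
    then show ?thesis using power_comb_closed by (simp add: factor_def)
  next
    case (Suc m')
    then show ?thesis using 0[of 0] linear_in_carrier[OF y]
      by (auto simp: power_comb_0 factor_def intro!: bexI[of _ "\<zero>\<^bsub>poly_ring R\<^esub>"] P.nat_pow_closed)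
  qed
next
  case (Suc n)
  show ?case
  proof (cases m)
    case 0
    then show ?thesis using power_comb_closed by (simp add: factor_def)
  next
    case (Suc m')
    \<comment> \<open>The factor X - y accounts for one order, so the hypothesis is used at
      \<open>Suc k\<close> in place of \<open>k\<close>.\<close>
    have "[\<one>, \<ominus> y] [^]\<^bsub>poly_ring R\<^esub> m' divides\<^bsub>poly_ring R\<^esub> power_comb c U y j n"
      using Suc.prems[of "Suc _"] Suc by (intro Suc.IH) auto
    moreover have "[\<one>, \<ominus> y] [^]\<^bsub>poly_ring R\<^esub> m divides\<^bsub>poly_ring R\<^esub> power_comb c U y (Suc j) n"
      using Suc.prems by (intro Suc.IH) auto
    ultimately show ?thesis
      unfolding Suc power_comb_Suc
      by (intro P.pow_Suc_divides_combination power_comb_closed linear_in_carrier y)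
  qed
qed

text \<open>Here the term of order 0 at \<open>y\<close> is \<open>e\<close> and is subtracted. In
  the recursion \<open>e\<close> stays with the second summand; the first is already divisible by X
  - y.\<close>

lemma linear_pow_divides_power_comb_minus:
  assumes e: "e \<in> carrier R"
    and "\<And>k. k < m \<Longrightarrow> k \<le> n \<Longrightarrow>
      (\<Oplus>u\<in>U. c u \<otimes> (y \<ominus> u) [^] (j + n - k)) = (if k = 0 then e else \<zero>)"
  shows "[\<one>, \<ominus> y] [^]\<^bsub>poly_ring R\<^esub> m divides\<^bsub>poly_ring R\<^esub> (power_comb c U y j n \<ominus>\<^bsub>poly_ring R\<^esub> poly_of_const e)"
  using assms(2)
proof (induction n arbitrary: j)
  case 0
  show ?case
  proof (cases m)
    case 0
    then show ?thesis using power_comb_closed e by (simp add: factor_def)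
  next
    case (Suc m')
    then have "power_comb c U y j 0 \<ominus>\<^bsub>poly_ring R\<^esub> poly_of_const e = \<zero>\<^bsub>poly_ring R\<^esub>"
      using 0[of 0] e by (simp add: power_comb_0 P.r_neg P.minus_eq)
    then show ?thesis using linear_in_carrier[OF y]
      by (auto simp: factor_def intro!: bexI[of _ "\<zero>\<^bsub>poly_ring R\<^esub>"] P.nat_pow_closed)
  qed
next
  case (Suc n)
  show ?case
  proof (cases m)
    case 0
    then show ?thesis using power_comb_closed e by (simp add: factor_def)
  next
    case (Suc m')
    \<comment> \<open>The shift to \<open>Suc k\<close> skips the exceptional index 0, so all sums
      needed here are zero.\<close>
    have "[\<one>, \<ominus> y] [^]\<^bsub>poly_ring R\<^esub> m' divides\<^bsub>poly_ring R\<^esub> power_comb c U y j n"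
      using Suc.prems[of "Suc _"] Suc by (intro linear_pow_divides_power_comb) auto
    moreover have "[\<one>, \<ominus> y] [^]\<^bsub>poly_ring R\<^esub> m divides\<^bsub>poly_ring R\<^esub> (power_comb c U y (Suc j) n \<ominus>\<^bsub>poly_ring R\<^esub> poly_of_const e)"
      using Suc.prems by (intro Suc.IH) auto
    moreover have "power_comb c U y j (Suc n) \<ominus>\<^bsub>poly_ring R\<^esub> poly_of_const e
      = [\<one>, \<ominus> y] \<otimes>\<^bsub>poly_ring R\<^esub> power_comb c U y j n \<oplus>\<^bsub>poly_ring R\<^esub>
          (power_comb c U y (Suc j) n \<ominus>\<^bsub>poly_ring R\<^esub> poly_of_const e)"
      unfolding power_comb_Suc P.minus_eq
      by (intro P.a_assoc P.m_closed power_comb_closed linear_in_carrier y P.a_inv_closed C.hom_closed e)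
    ultimately show ?thesis
      unfolding Suc by (simp only:) (intro P.pow_Suc_divides_combination power_comb_closed linear_in_carrier y P.minus_closed C.hom_closed e)
  qed
qed

text \<open>The coefficient of (X - y)^k involves the power sum of exponent j + n - k, which
  vanishes once this is below \<open>M\<close>; hence the degree drops by \<open>M\<close>. As
  \<open>length\<close> is degree plus one on nonzero polynomials, truncated subtraction also covers
  the zero polynomial.\<close>

lemma length_power_comb_le:
  assumes "\<And>i. i < M \<Longrightarrow> (\<Oplus>u\<in>U. c u \<otimes> (y \<ominus> u) [^] i) = \<zero>"
  shows "length (power_comb c U y j n) \<le> Suc (j + n) - M"
proof (induction n arbitrary: j)
  case 0
  show ?case
  proof (cases "j < M")
    case True
    then show ?thesis using assms by (simp add: power_comb_0 poly_of_const_def)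
  next
    case False
    then show ?thesis by (auto simp: power_comb_0 poly_of_const_def)
  qed
next
  case (Suc n)
  let ?A = "power_comb c U y j n"
  have A: "polynomial (carrier R) ?A" and L: "polynomial (carrier R) [\<one>, \<ominus> y]"
    using power_comb_closed linear_in_carrier[OF y] by (auto simp: univ_poly_carrier)
  have "length (poly_mult [\<one>, \<ominus> y] ?A) \<le> Suc (j + Suc n) - M"
  proof (cases "?A = []")
    case True
    then show ?thesis using poly_mult_zero(2)[of "[\<one>, \<ominus> y]"] y by simp
  next
    case False
    then have "degree (poly_mult [\<one>, \<ominus> y] ?A) = Suc (degree ?A)"
      using poly_mult_degree_eq[OF carrier_is_subring L A] by simp
    then have "length (poly_mult [\<one>, \<ominus> y] ?A) = Suc (length ?A)" using False by (cases ?A) auto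
    with Suc[of j] False show ?thesis by (cases ?A) auto
  qed
  moreover have "length (power_comb c U y (Suc j) n) \<le> Suc (j + Suc n) - M" using Suc[of "Suc j"] by simp
  ultimately show ?case
    using poly_add_length_le[of "poly_mult [\<one>, \<ominus> y] ?A" "power_comb c U y (Suc j) n"]
    by (simp add: power_comb_Suc univ_poly_add univ_poly_mult del: poly_mult.simps poly_add.simps)
qed

end

text \<open>For exponent 0 the factors containing the base point are 1. This permits one polynomial
  to be studied at all points of \<open>V\<close> and at \<open>z\<close>.\<close>

lemma power_comb_zero_indep:
  assumes "finite U" "U \<subseteq> carrier R" "c \<in> U \<rightarrow> carrier R" "z \<in> carrier R"
  shows "power_comb c U y 0 n = power_comb c U z 0 n"
  unfolding power_comb_def
proof (rule P.finsum_cong')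
  show "poly_of_const (c u \<otimes> (y \<ominus> u) [^] (0::nat)) \<otimes>\<^bsub>poly_ring R\<^esub> [\<one>, \<ominus> u] [^]\<^bsub>poly_ring R\<^esub> n
      = poly_of_const (c u \<otimes> (z \<ominus> u) [^] (0::nat)) \<otimes>\<^bsub>poly_ring R\<^esub> [\<one>, \<ominus> u] [^]\<^bsub>poly_ring R\<^esub> n" for u
    by simp
qed (intro refl Pi_I power_comb_term_closed(2)[OF assms]; assumption)+

text \<open>The Stepanov count, stated through values of \<open>d\<close>-th powers alone. The point
  \<open>z\<close> certifies that the auxiliary polynomial is nonzero: its value there is
  \<open>f \<ominus> e\<close>.\<close>

lemma card_times_card_le_of_constant_powers:
  assumes "finite U" "U \<subseteq> carrier R" "finite V" "V \<subseteq> carrier R" "z \<in> carrier R"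
    and e: "e \<in> carrier R" and f: "f \<in> carrier R" and "e \<noteq> f"
    and UV: "\<And>u v. u \<in> U \<Longrightarrow> v \<in> V \<Longrightarrow> (v \<ominus> u) [^] (d::nat) = e"
    and Uz: "\<And>u. u \<in> U \<Longrightarrow> (z \<ominus> u) [^] d = f"
  shows "card U * card V \<le> d"
proof (cases "U = {}")
  case False
  define m where "m = card U"
  have m: "m > 0" using False assms(1) by (simp add: m_def card_gt_0_iff)
  obtain c where c: "c \<in> U \<rightarrow> carrier R" and sums: "\<And>y k. y \<in> carrier R \<Longrightarrow> k < m \<Longrightarrow>
      (\<Oplus>u\<in>U. c u \<otimes> (y \<ominus> u) [^] k) = (if Suc k = m then \<one> else \<zero>)"
    using exists_power_sum_weights[OF assms(1) False assms(2)] unfolding m_def by blast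
  \<comment> \<open>The weights cancel the top \<open>m - 1\<close> degrees, leaving degree at most
    \<open>d\<close>; yet for every k < m the exponent N - k still contains a full
    \<open>d\<close>-th power.\<close>
  define N where "N = d + (m - 1)"
  define A where "A = power_comb c U z 0 N"
  have A: "A \<in> carrier (poly_ring R)"
    unfolding A_def using assms c by (intro power_comb_closed)
  \<comment> \<open>Pulling out the constant \<open>d\<close>-th power leaves exponent
    \<open>m - 1 - k\<close>, where the weights give 1 for \<open>k = 0\<close> and 0
    otherwise.\<close>
  have sum_top: "(\<Oplus>u\<in>U. c u \<otimes> (y \<ominus> u) [^] (0 + N - k)) = (if k = 0 then a else \<zero>)"
    if y: "y \<in> carrier R" and a: "a \<in> carrier R" and ya: "\<And>u. u \<in> U \<Longrightarrow> (y \<ominus> u) [^] d = a" and k: "k < m" for y a k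
  proof -
    have "(\<Oplus>u\<in>U. c u \<otimes> (y \<ominus> u) [^] (0 + N - k)) = (\<Oplus>u\<in>U. a \<otimes> (c u \<otimes> (y \<ominus> u) [^] (m - 1 - k)))"
    proof (rule finsum_cong')
      fix u assume u: "u \<in> U"
      have cc: "u \<in> carrier R" "c u \<in> carrier R" using u assms(2) c by auto
      have "0 + N - k = d + (m - 1 - k)" using k by (simp add: N_def)
      then have "(y \<ominus> u) [^] (0 + N - k) = a \<otimes> (y \<ominus> u) [^] (m - 1 - k)"
        using ya[OF u] cc y by (simp flip: nat_pow_mult)
      then show "c u \<otimes> (y \<ominus> u) [^] (0 + N - k) = a \<otimes> (c u \<otimes> (y \<ominus> u) [^] (m - 1 - k))"
        using cc y a by (simp add: m_lcomm)
    qed (use assms(2) c y a in \<open>auto simp: subset_iff Pi_iff\<close>)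
    also have "\<dots> = a \<otimes> (\<Oplus>u\<in>U. c u \<otimes> (y \<ominus> u) [^] (m - 1 - k))"
      using assms(1,2) c y a by (subst finsum_rdistr) auto
    also have "\<dots> = (if k = 0 then a else \<zero>)"
      using sums[OF y, of "m - 1 - k"] k a by auto
    finally show ?thesis .
  qed
  \<comment> \<open>Needed to order 1 at \<open>z\<close> with value \<open>f\<close>, and to order
    \<open>m\<close> at the points of \<open>V\<close> with value \<open>e\<close>.\<close>
  have divides: "[\<one>, \<ominus> y] [^]\<^bsub>poly_ring R\<^esub> m' divides\<^bsub>poly_ring R\<^esub> (A \<ominus>\<^bsub>poly_ring R\<^esub> poly_of_const a)"
    if "y \<in> carrier R" "a \<in> carrier R" "\<And>u. u \<in> U \<Longrightarrow> (y \<ominus> u) [^] d = a" "m' \<le> m" for y a m'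
  proof -
    have "[\<one>, \<ominus> y] [^]\<^bsub>poly_ring R\<^esub> m' divides\<^bsub>poly_ring R\<^esub> (power_comb c U y 0 N \<ominus>\<^bsub>poly_ring R\<^esub> poly_of_const a)"
      using that assms c by (intro linear_pow_divides_power_comb_minus sum_top) auto
    then show ?thesis
      unfolding A_def using power_comb_zero_indep[OF assms(1,2) c assms(5), of y] by simp
  qed
  define g where "g = A \<ominus>\<^bsub>poly_ring R\<^esub> poly_of_const e"
  have g: "g \<in> carrier (poly_ring R)" using A e by (simp add: g_def)
  have "g \<noteq> []"
  proof
    assume "g = []"
    then have "g = \<zero>\<^bsub>poly_ring R\<^esub>" by (simp add: univ_poly_zero)
    \<comment> \<open>Otherwise X - z would divide the nonzero constant
      \<open>e \<ominus> f\<close>.\<close>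
    then have "A = poly_of_const e" using A e by (simp add: g_def)
    then have "A \<ominus>\<^bsub>poly_ring R\<^esub> poly_of_const f = poly_of_const (e \<ominus> f)"
      using e f by (simp add: minus_eq P.minus_eq)
    moreover have "poly_of_const (e \<ominus> f) = [e \<ominus> f]"
      using e f \<open>e \<noteq> f\<close> by (simp add: poly_of_const_def)
    ultimately have "[\<one>, \<ominus> z] pdivides [e \<ominus> f]"
      using divides[OF assms(5) f Uz, of 1] m linear_in_carrier[OF assms(5)] by (simp add: pdivides_def)
    moreover have "[e \<ominus> f] \<in> carrier (poly_ring R)"
      using e f \<open>e \<noteq> f\<close> by (simp add: univ_poly_def polynomial_def)
    ultimately have "degree [\<one>, \<ominus> z] \<le> degree [e \<ominus> f]"
      using linear_in_carrier[OF assms(5)] by (intro pdivides_imp_degree_le[OF carrier_is_subring]) auto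
    then show False by simp
  qed
  have "length A \<le> Suc d"
    using length_power_comb_le[OF assms(1,2) c assms(5), of "m - 1" 0 N] sums[OF assms(5)] m
    by (simp add: A_def N_def)
  moreover have "g = poly_add A (poly_of_const (\<ominus> e))"
    using e by (simp add: g_def P.minus_eq univ_poly_add del: poly_add.simps)
  moreover have "length (poly_of_const (\<ominus> e)) \<le> 1" by (simp add: poly_of_const_def)
  ultimately have "length g \<le> Suc d"
    using poly_add_length_le[of A "poly_of_const (\<ominus> e)"]
    by (auto simp: max_def simp del: poly_add.simps split: if_splits)
  then have deg: "degree g \<le> d" by simp
  have "m \<le> count (roots g) v" if "v \<in> V" for v
  proof -
    have v: "v \<in> carrier R" using that assms(4) by auto
    have "[\<one>, \<ominus> v] [^]\<^bsub>poly_ring R\<^esub> m pdivides g"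
      using divides[OF v e, of m] UV that by (simp add: g_def pdivides_def)
    then show ?thesis
      using alg_multE(2)[OF v g \<open>g \<noteq> []\<close>] by (simp add: alg_mult_eq_count_roots[OF g])
  qed
  \<comment> \<open>Count roots with multiplicity: each point of \<open>V\<close> contributes at
    least \<open>m\<close>, and the total is at most the degree.\<close>
  then have "card U * card V \<le> (\<Sum>v\<in>V. count (roots g) v)"
    using sum_bounded_below[of V m "count (roots g)"] by (simp add: m_def mult.commute)
  also have "\<dots> \<le> (\<Sum>v\<in>V \<union> set_mset (roots g). count (roots g) v)"
    using assms(3) by (intro sum_mono2) auto
  also have "\<dots> = size (roots g)"
    unfolding size_multiset_overloaded_eq using assms(3)
    by (intro sum.mono_neutral_right) (auto simp: not_in_iff)
  also have "\<dots> \<le> d" using size_roots_le_degree[OF g] deg by simp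
  finally show ?thesis .
qed simp

end

section \<open>Half-order powers and squares in finite fields of odd order\<close>

lemma (in field) nonsquare_pow_half_order:
  assumes fin: "finite (carrier R)" and ord: "card (carrier R) = Suc (2 * d)"
    and x: "x \<in> carrier R" and nsq: "\<And>y. y \<in> carrier R \<Longrightarrow> y \<otimes> y \<noteq> x"
  shows "x [^] d = \<ominus> \<one>"
proof -
  interpret G: group "Multiplicative_Group.mult_of R" by (rule field_mult_group)
  have oG: "order (Multiplicative_Group.mult_of R) = 2 * d"
    using order_mult_of[OF fin] ord by (simp add: order_def)
  have "x \<noteq> \<zero>" using nsq[of \<zero>] by auto
  with x have xG: "x \<in> carrier (Multiplicative_Group.mult_of R)" by simp
  obtain g where g: "g \<in> carrier (Multiplicative_Group.mult_of R)" and gen: "carrier (Multiplicative_Group.mult_of R) = {g [^]\<^bsub>Multiplicative_Group.mult_of R\<^esub> i | i::nat. i \<in> UNIV}"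
    using finite_field_mult_group_has_gen[OF fin] unfolding Multiplicative_Group.nat_pow_mult_of by blast
  have gR: "g \<in> carrier R" using g by simp
  obtain i :: nat where i: "x = g [^] i" using xG unfolding gen Multiplicative_Group.nat_pow_mult_of by blast
  \<comment> \<open>An even exponent of the generator would make \<open>x\<close> a square.\<close>
  have "odd i"
  proof
    assume "even i"
    then obtain k where "i = k + k" by (auto elim: evenE simp: mult_2)
    then have "g [^] k \<otimes> g [^] k = x" using gR i by (simp add: nat_pow_mult)
    then show False using nsq gR by auto
  qed
  then obtain k where k: "i = Suc (2 * k)" by (auto elim: oddE)
  have ord1: "y [^] (2 * d) = \<one>" if "y \<in> carrier R" "y \<noteq> \<zero>" for y
    using G.pow_order_eq_1[of y] that oG by (simp add: Multiplicative_Group.nat_pow_mult_of)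
  have "x [^] d = g [^] (i * d)" using gR by (simp add: i nat_pow_pow)
  also have "i * d = 2 * d * k + d" by (simp add: k)
  also have "g [^] \<dots> = (g [^] (2 * d)) [^] k \<otimes> g [^] d" using gR by (simp add: nat_pow_mult nat_pow_pow)
  also have "\<dots> = g [^] d" using g ord1[of g] by simp
  finally have xg: "x [^] d = g [^] d" .
  have d: "d > 0" using oG G.order_gt_0_iff_finite fin by simp
  \<comment> \<open>Otherwise the powers with exponent below \<open>d\<close> would exhaust a group
    of order \<open>2 * d\<close>. Since the square of \<open>g [^] d\<close> is 1, only -1
    remains.\<close>
  have "g [^] d \<noteq> \<one>"
  proof
    assume gd: "g [^] d = \<one>"
    have "carrier (Multiplicative_Group.mult_of R) \<subseteq> (\<lambda>i. g [^] i) ` {..<d}"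
    proof
      fix y assume "y \<in> carrier (Multiplicative_Group.mult_of R)"
      then obtain j :: nat where "y = g [^] j" unfolding gen Multiplicative_Group.nat_pow_mult_of by blast
      also have "g [^] j = g [^] (d * (j div d) + j mod d)" by simp
      also have "\<dots> = (g [^] d) [^] (j div d) \<otimes> g [^] (j mod d)"
        using gR by (simp only: nat_pow_pow nat_pow_mult)
      also have "\<dots> = g [^] (j mod d)" using gd gR by simp
      finally show "y \<in> (\<lambda>i. g [^] i) ` {..<d}" using d by auto
    qed
    then have "card (carrier (Multiplicative_Group.mult_of R)) \<le> d"
      using surj_card_le[of "{..<d}"] by (metis card_lessThan finite_lessThan)
    then show False using oG d by (simp add: order_def)
  qed
  moreover have "(g [^] d \<ominus> \<one>) \<otimes> (g [^] d \<oplus> \<one>) = \<zero>"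
  proof -
    have "g [^] d \<otimes> g [^] d = \<one>" using ord1[of g] g by (simp add: nat_pow_mult mult_2)
    moreover have "(g [^] d \<ominus> \<one>) \<otimes> (g [^] d \<oplus> \<one>) = g [^] d \<otimes> g [^] d \<ominus> \<one>"
    proof -
      have "g [^] d \<in> carrier R" using gR by simp
      then show ?thesis by algebra
    qed
    ultimately show ?thesis by simp
  qed
  ultimately have "g [^] d \<oplus> \<one> = \<zero>" using gR integral[of "g [^] d \<ominus> \<one>" "g [^] d \<oplus> \<one>"] by auto
  then show ?thesis using xg gR by (simp add: minus_equality)
qed

lemma (in field) square_pow_half_order:
  assumes fin: "finite (carrier R)" and ord: "card (carrier R) = Suc (2 * d)"
    and y: "y \<in> carrier R" and "y \<noteq> \<zero>"
  shows "(y \<otimes> y) [^] d = \<one>"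
proof -
  interpret G: group "Multiplicative_Group.mult_of R" by (rule field_mult_group)
  have "order (Multiplicative_Group.mult_of R) = 2 * d"
    using order_mult_of[OF fin] ord by (simp add: order_def)
  then have "y [^] (2 * d) = \<one>"
    using G.pow_order_eq_1[of y] assms by (simp add: Multiplicative_Group.nat_pow_mult_of)
  then show ?thesis using y by (simp add: nat_pow_distrib nat_pow_mult mult_2)
qed

text \<open>By Lagrange in the additive group, 2k + 1 = 0 in the ring when its order is 2k + 1, so
  -k is an inverse of 2.\<close>

lemma (in cring) two_in_Units_of_odd_order:
  assumes fin: "finite (carrier R)" and odd: "odd (card (carrier R))"
  shows "\<one> \<oplus> \<one> \<in> Units R"
proof -
  obtain k where k: "card (carrier R) = Suc (2 * k)" using odd by (auto elim: oddE)
  have "[card (carrier R)] \<cdot> \<one> = \<zero>"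
    using add.pow_order_eq_1[of \<one>] by (simp add: order_def)
  then have "([k] \<cdot> \<one>) \<oplus> ([k] \<cdot> \<one>) \<oplus> \<one> = \<zero>"
    unfolding k by (simp add: mult_2 add.nat_pow_mult)
  moreover define a where "a = [k] \<cdot> \<one>"
  ultimately have 1: "a \<oplus> a \<oplus> \<one> = \<zero>" and a: "a \<in> carrier R" by auto
  have "\<ominus> a \<otimes> (\<one> \<oplus> \<one>) = \<one>"
  proof -
    have "\<ominus> a \<otimes> (\<one> \<oplus> \<one>) = \<one> \<ominus> (a \<oplus> a \<oplus> \<one>)" using a by algebra
    then show ?thesis using 1 by (simp add: minus_eq)
  qed
  then show ?thesis using a Units_one_closed unit_factor[of "\<one> \<oplus> \<one>" "\<ominus> a"]
    by (metis a_closed a_inv_closed m_comm one_closed)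
qed

text \<open>Take z = 0 in the Stepanov count. With s = (-1)^d the constant powers are -s on the
  differences v - u and s on 0 - u, so no case distinction on whether -1 is a square arises.\<close>

lemma (in field) card_times_card_le_half_order:
  assumes fin: "finite (carrier R)" and ord: "card (carrier R) = Suc (2 * d)"
    and U: "U \<subseteq> carrier R" and V: "V \<subseteq> carrier R"
    and sq: "\<And>u. u \<in> U \<Longrightarrow> u \<noteq> \<zero> \<and> (\<exists>y\<in>carrier R. u = y \<otimes> y)"
    and nsq: "\<And>u v y. u \<in> U \<Longrightarrow> v \<in> V \<Longrightarrow> y \<in> carrier R \<Longrightarrow> y \<otimes> y \<noteq> u \<ominus> v"
  shows "card U * card V \<le> d"
proof -
  define s where "s = (\<ominus> \<one>) [^] d"
  have s: "s \<in> carrier R" by (simp add: s_def)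
  have "\<one> \<oplus> \<one> \<noteq> \<zero>"
    using two_in_Units_of_odd_order[OF fin] ord by (auto simp: field_Units)
  moreover have "s \<noteq> \<zero>"
  proof
    assume "s = \<zero>"
    moreover have "s \<otimes> s = (\<ominus> \<one> \<otimes> \<ominus> \<one>) [^] d" by (simp add: s_def nat_pow_distrib)
    moreover have "\<ominus> \<one> \<otimes> \<ominus> \<one> = \<one>" by algebra
    ultimately show False by simp
  qed
  ultimately have "(\<one> \<oplus> \<one>) \<otimes> s \<noteq> \<zero>" using s integral by blast
  moreover have "(\<one> \<oplus> \<one>) \<otimes> s = s \<ominus> \<ominus> s" using s by algebra
  ultimately have ne: "\<ominus> s \<noteq> s" using s by auto
  have neg: "(\<ominus> x) [^] d = s \<otimes> x [^] d" if "x \<in> carrier R" for x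
  proof -
    have "\<ominus> x = \<ominus> \<one> \<otimes> x" using that by algebra
    then show ?thesis using that by (simp add: s_def nat_pow_distrib)
  qed
  have UV: "(v \<ominus> u) [^] d = \<ominus> s" if "u \<in> U" "v \<in> V" for u v
  proof -
    have uv: "u \<in> carrier R" "v \<in> carrier R" using that U V by auto
    have "v \<ominus> u = \<ominus> (u \<ominus> v)" using uv by algebra
    moreover have "(u \<ominus> v) [^] d = \<ominus> \<one>"
      using uv nsq[OF that] by (intro nonsquare_pow_half_order[OF fin ord]) auto
    ultimately show ?thesis using neg[of "u \<ominus> v"] uv s by (simp add: r_minus)
  qed
  have U0: "(\<zero> \<ominus> u) [^] d = s" if u: "u \<in> U" for u
  proof -
    obtain y where y: "y \<in> carrier R" "u = y \<otimes> y" "u \<noteq> \<zero>" using sq[OF u] by auto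
    then have "y \<noteq> \<zero>" by auto
    then have "u [^] d = \<one>" using square_pow_half_order[OF fin ord y(1)] y(2) by simp
    moreover have "\<zero> \<ominus> u = \<ominus> u" using y by (simp add: minus_eq)
    ultimately show ?thesis using neg[of u] y s by simp
  qed
  show ?thesis
    using s U V finite_subset[OF U fin] finite_subset[OF V fin]
    by (intro card_times_card_le_of_constant_powers[OF _ _ _ _ zero_closed _ _ ne UV U0]) auto
qed

section \<open>Counting in fibres\<close>

lemma card_le_fibres:
  assumes "finite A" and "\<And>x. x \<in> A \<Longrightarrow> card {x' \<in> A. f x' = f x} \<le> n"
  shows "card A \<le> n * card (f ` A)"
proof -
  have "A = (\<Union>y\<in>f ` A. {x \<in> A. f x = y})" by auto
  then have "card A \<le> (\<Sum>y\<in>f ` A. card {x \<in> A. f x = y})"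
    using card_UN_le[of "f ` A" "\<lambda>y. {x \<in> A. f x = y}"] assms(1) by simp
  also have "\<dots> \<le> n * card (f ` A)"
    using sum_bounded_above[of "f ` A" "\<lambda>y. card {x \<in> A. f x = y}" n] assms(2) by (auto simp: mult.commute)
  finally show ?thesis .
qed

text \<open>The term $1$ in $4d + 1$ pays for splitting the common residues in a non-integral ratio.\<close>
lemma card_times_card_le_of_fibres:
  fixes p :: "'a \<Rightarrow> 'b" and s d :: nat
  assumes fin: "finite Y" "finite Z" and disj: "Y \<inter> Z = {}"
    and fib: "\<And>x. card {y \<in> Y \<union> Z. p y = x} \<le> s"
    and bound: "\<And>A B. A \<subseteq> p ` Y \<Longrightarrow> B \<subseteq> p ` Z \<Longrightarrow> A \<inter> B = {} \<Longrightarrow> card A * card B \<le> d"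
  shows "4 * (card Y * card Z) \<le> s\<^sup>2 * (4 * d + 1)"
proof -
  have fibS: "card S \<le> s * card (p ` S)" if "S \<subseteq> Y \<union> Z" for S
  proof (rule card_le_fibres)
    show "finite S" using that fin finite_subset by blast
    show "card {x' \<in> S. p x' = p x} \<le> s" for x
      using card_mono[of "{y \<in> Y \<union> Z. p y = p x}" "{x' \<in> S. p x' = p x}"] fib[of "p x"] that fin by fastforce
  qed
  \<comment> \<open>The residues common to both sets are the only obstruction to applying
    \<open>bound\<close> to the full images.\<close>
  define T where "T = p ` Y \<inter> p ` Z"
  have finT: "finite T" using fin by (simp add: T_def)
  define YT where "YT = {y \<in> Y. p y \<in> T}"
  define ZT where "ZT = {y \<in> Z. p y \<in> T}"
  define w where "w = card YT"
  \<comment> \<open>Above a common residue the disjoint sets share one fibre of size at most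
    \<open>s\<close>.\<close>
  have wz: "w + card ZT \<le> s * card T"
  proof -
    have "w + card ZT = card (YT \<union> ZT)"
      unfolding w_def using fin disj by (intro card_Un_disjoint[symmetric]) (auto simp: YT_def ZT_def)
    also have "\<dots> \<le> s * card (p ` (YT \<union> ZT))" by (intro fibS) (auto simp: YT_def ZT_def)
    also have "\<dots> \<le> s * card T"
      using finT by (intro mult_left_mono card_mono) (auto simp: YT_def ZT_def)
    finally show ?thesis .
  qed
  have outside: "card S \<le> s * card (p ` S - T) + card {y \<in> S. p y \<in> T}" if "S \<subseteq> Y \<union> Z" for S
  proof -
    have "S = {y \<in> S. p y \<notin> T} \<union> {y \<in> S. p y \<in> T}" by auto
    then have "card S \<le> card {y \<in> S. p y \<notin> T} + card {y \<in> S. p y \<in> T}"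
      by (metis card_Un_le)
    moreover have "card {y \<in> S. p y \<notin> T} \<le> s * card (p ` {y \<in> S. p y \<notin> T})"
      using that by (intro fibS) auto
    moreover have "p ` {y \<in> S. p y \<notin> T} = p ` S - T" by auto
    ultimately show ?thesis by simp
  qed
  define a b t where "a = card (p ` Y - T)" and "b = card (p ` Z - T)" and "t = card T"
  have Y: "card Y \<le> s * a + w" using outside[of Y] by (simp add: a_def w_def YT_def)
  have Z: "card Z + w \<le> s * (b + t)"
    using outside[of Z] wz by (simp add: b_def t_def ZT_def algebra_simps)
  \<comment> \<open>Assign \<open>k\<close> common residues to the image of \<open>Y\<close> and the
    others to the image of \<open>Z\<close>; the resulting sets are disjoint.\<close>
  have split: "(a + k) * (b + t - k) \<le> d" if "k \<le> t" for k
  proof -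
    obtain T1 where T1: "T1 \<subseteq> T" "card T1 = k" using \<open>k \<le> t\<close> unfolding t_def by (meson obtain_subset_with_card_n)
    have "card ((p ` Y - T) \<union> T1) = a + k"
      using T1 finT fin finite_subset[OF T1(1)] by (subst card_Un_disjoint) (auto simp: a_def)
    moreover have "card ((p ` Z - T) \<union> (T - T1)) = b + (t - k)"
      using T1 finT fin finite_subset[OF T1(1)]
      by (subst card_Un_disjoint) (auto simp: b_def t_def card_Diff_subset)
    moreover have "card ((p ` Y - T) \<union> T1) * card ((p ` Z - T) \<union> (T - T1)) \<le> d"
      using T1(1) by (intro bound) (auto simp: T_def)
    ultimately show ?thesis using that by simp
  qed
  show ?thesis
  proof (cases "s = 0")
    case True
    then show ?thesis using Y wz by simp
  next
    case False
    \<comment> \<open>The part of \<open>Y\<close> above \<open>T\<close> has the size of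
      \<open>k\<close> full fibres and a remainder \<open>f\<close>, so the ratio lies between the
      splittings \<open>k\<close> and \<open>k + 1\<close>.\<close>
    define k f where "k = w div s" and "f = w mod s"
    have w: "w = s * k + f" and f: "f < s" using False by (simp_all add: k_def f_def)
    have "w \<le> s * t" using wz by (simp add: t_def)
    then have sk: "s * k + f \<le> s * t" using w by linarith
    have k: "k \<le> t"
    proof -
      have "s * k \<le> s * t" using sk by linarith
      then show ?thesis using False by simp
    qed
    have k': "k + 1 \<le> t" if "f > 0"
    proof -
      have "s * k < s * t" using sk that by linarith
      then show ?thesis by simp
    qed
    define P Q S F D where "P = int (a + k)" and "Q = int (b + t - k)" and "S = int s" and "F = int f" and "D = int d"
    have Yi: "int (card Y) \<le> S * P + F" using Y by (simp add: P_def S_def F_def w algebra_simps flip: of_nat_mult of_nat_add)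
    have Zi: "int (card Z) \<le> S * Q - F"
    proof -
      have "int (card Z) + S * int k + F \<le> S * int (b + t)"
        using Z by (simp add: S_def F_def w flip: of_nat_mult of_nat_add)
      then show ?thesis using k by (simp add: Q_def of_nat_diff algebra_simps)
    qed
    have PQ: "P * Q \<le> D" using split[OF k] by (simp only: P_def Q_def D_def of_nat_mult[symmetric] of_nat_le_iff)
    have PQ': "F * ((P + 1) * (Q - 1)) \<le> F * D"
    proof (cases "f = 0")
      case False
      then have k1: "k + 1 \<le> t" using k' by simp
      then have "P + 1 = int (a + (k + 1))" "Q - 1 = int (b + t - (k + 1))"
        by (auto simp: P_def Q_def of_nat_diff)
      then have "(P + 1) * (Q - 1) \<le> D" using split[OF k1] by (simp only: D_def of_nat_mult[symmetric] of_nat_le_iff)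
      then show ?thesis by (intro mult_left_mono) (auto simp: F_def)
    qed (simp add: F_def)
    have F: "0 \<le> F" "F < S" using f by (auto simp: F_def S_def)
    have "int (card Y) * int (card Z) \<le> (S * P + F) * (S * Q - F)"
      using Yi Zi by (intro mult_mono) auto
    \<comment> \<open>Interpolation between the two integral splittings with weights
      \<open>S - F\<close> and \<open>F\<close>; the defect \<open>F * (S - F)\<close> is at most a
      quarter of the square of \<open>S\<close>.\<close>
    also have "\<dots> = S * (S - F) * (P * Q) + S * (F * ((P + 1) * (Q - 1))) + F * (S - F)"
      by (simp add: algebra_simps)
    also have "\<dots> \<le> S * (S - F) * D + S * (F * D) + F * (S - F)"
      using F by (intro add_mono mult_left_mono[OF PQ] mult_left_mono[OF PQ']) auto
    finally have "4 * (int (card Y) * int (card Z)) \<le> 4 * S\<^sup>2 * D + 4 * (F * (S - F))"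
      by (simp add: algebra_simps power2_eq_square)
    also have "4 * (F * (S - F)) \<le> S\<^sup>2"
      using zero_le_power2[of "S - 2 * F"] by (simp add: algebra_simps power2_eq_square)
    finally have "int (4 * (card Y * card Z)) \<le> int (s\<^sup>2 * (4 * d + 1))"
      by (simp add: S_def D_def algebra_simps)
    then show ?thesis by (simp only: of_nat_le_iff)
  qed
qed

section \<open>Lifting from the residue field\<close>

text \<open>Models the projection onto the residue field by what lifting requires;
  \<open>Units_iff\<close> expresses locality, since it makes the nonunits the kernel of
  \<open>h\<close>.\<close>

locale unit_reflecting_hom = ring_hom_cring R K h + K: field K for R (structure) and K and h +
  assumes finite_carrier: "finite (carrier R)"
    and surj: "h ` carrier R = carrier K"
    and Units_iff: "x \<in> carrier R \<Longrightarrow> x \<in> Units R \<longleftrightarrow> h x \<noteq> \<zero>\<^bsub>K\<^esub>"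
begin

text \<open>Zero divisors do no harm: x - y and x + y have product 0 and sum the unit 2x. Nonunits
  are closed under addition, so one factor is a unit and the other must vanish.\<close>

lemma square_eq_imp:
  assumes "\<one> \<oplus> \<one> \<in> Units R" and x: "x \<in> Units R" and y: "y \<in> carrier R" and eq: "x \<otimes> x = y \<otimes> y"
  shows "y = x \<or> y = \<ominus> x"
proof -
  have xR: "x \<in> carrier R" using x by auto
  have prod: "(x \<ominus> y) \<otimes> (x \<oplus> y) = \<zero>"
  proof -
    have "(x \<ominus> y) \<otimes> (x \<oplus> y) = x \<otimes> x \<ominus> y \<otimes> y" using xR y by algebra
    then show ?thesis using eq y by simp
  qed
  have "(x \<ominus> y) \<oplus> (x \<oplus> y) = (\<one> \<oplus> \<one>) \<otimes> x" using xR y by algebra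
  then have "(x \<ominus> y) \<oplus> (x \<oplus> y) \<in> Units R" using assms(1) x by simp
  then have "h (x \<ominus> y) \<oplus>\<^bsub>K\<^esub> h (x \<oplus> y) \<noteq> \<zero>\<^bsub>K\<^esub>"
    using xR y Units_iff[of "(x \<ominus> y) \<oplus> (x \<oplus> y)"] hom_add[of "x \<ominus> y" "x \<oplus> y"] by simp
  then have "h (x \<ominus> y) \<noteq> \<zero>\<^bsub>K\<^esub> \<or> h (x \<oplus> y) \<noteq> \<zero>\<^bsub>K\<^esub>"
    using S.l_zero[OF S.zero_closed] by metis
  then consider "x \<ominus> y \<in> Units R" | "x \<oplus> y \<in> Units R"
    using Units_iff[of "x \<ominus> y"] Units_iff[of "x \<oplus> y"] xR y by blast
  then show ?thesis
  proof cases
    case 1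
    then have "x \<oplus> y = \<zero>" using R.Units_l_cancel[of "x \<ominus> y" "x \<oplus> y" \<zero>] prod xR y by simp
    then show ?thesis using R.minus_equality[of y x] xR y by (simp add: R.a_comm)
  next
    case 2
    then have "x \<ominus> y = \<zero>" using R.Units_l_cancel[of "x \<oplus> y" "x \<ominus> y" \<zero>] prod xR y by (simp add: R.m_comm)
    then show ?thesis using xR y by auto
  qed
qed

text \<open>Squaring is injective, hence surjective, on the finite fibre above one.\<close>
lemma square_of_hom_one:
  assumes two: "\<one> \<oplus> \<one> \<in> Units R" and x: "x \<in> carrier R" and "h x = \<one>\<^bsub>K\<^esub>"
  shows "\<exists>y\<in>carrier R. x = y \<otimes> y"
proof -
  define H where "H = {g \<in> carrier R. h g = \<one>\<^bsub>K\<^esub>}"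
  have HU: "g \<in> Units R" if "g \<in> H" for g
    using that Units_iff by (simp add: H_def)
  have "inj_on (\<lambda>g. g \<otimes> g) H"
  proof (rule inj_onI)
    fix f g assume fg: "f \<in> H" "g \<in> H" "f \<otimes> f = g \<otimes> g"
    then consider "g = f" | "g = \<ominus> f" using square_eq_imp[OF two HU[OF fg(1)]] by (auto simp: H_def)
    then show "f = g"
    proof cases
      case 2
      have f: "f \<in> carrier R" using fg by (simp add: H_def)
      \<comment> \<open>Both \<open>f\<close> and its negative have residue 1, which would force 2 =
        0 in \<open>K\<close>.\<close>
      have "\<one>\<^bsub>K\<^esub> = \<ominus>\<^bsub>K\<^esub> \<one>\<^bsub>K\<^esub>"
        using fg 2 f by (simp add: H_def)
      then have "\<one>\<^bsub>K\<^esub> \<oplus>\<^bsub>K\<^esub> \<one>\<^bsub>K\<^esub> = \<zero>\<^bsub>K\<^esub>"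
        using S.r_neg S.one_closed by metis
      then have "h (\<one> \<oplus> \<one>) = \<zero>\<^bsub>K\<^esub>" by simp
      then show ?thesis using two Units_iff[of "\<one> \<oplus> \<one>"] by simp
    qed simp
  qed
  moreover have "(\<lambda>g. g \<otimes> g) ` H \<subseteq> H" by (auto simp: H_def)
  moreover have "finite H" using finite_carrier by (simp add: H_def)
  ultimately have "(\<lambda>g. g \<otimes> g) ` H = H" by (intro endo_inj_surj)
  then have "x \<in> (\<lambda>g. g \<otimes> g) ` H" using assms by (simp add: H_def)
  then show ?thesis by (auto simp: H_def)
qed

text \<open>Lift the root \<open>k\<close> to a unit \<open>z\<close> and divide by its square: the
  quotient has residue 1 and hence is a square.\<close>

lemma square_lift:
  assumes two: "\<one> \<oplus> \<one> \<in> Units R" and x: "x \<in> carrier R" and k: "k \<in> carrier K"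
    and eq: "h x = k \<otimes>\<^bsub>K\<^esub> k" and nz: "h x \<noteq> \<zero>\<^bsub>K\<^esub>"
  shows "\<exists>y\<in>carrier R. x = y \<otimes> y"
proof -
  obtain z where z: "z \<in> carrier R" "k = h z" using k surj by blast
  have "k \<noteq> \<zero>\<^bsub>K\<^esub>" using eq nz S.l_null[OF k] by metis
  then have zU: "z \<in> Units R" using z Units_iff by metis
  define i where "i = inv z"
  have i: "i \<in> carrier R" "i \<otimes> z = \<one>" using zU by (auto simp: i_def)
  have pi: "h i \<otimes>\<^bsub>K\<^esub> k = \<one>\<^bsub>K\<^esub>"
    using i z by (simp flip: hom_mult)
  define j where "j = h i"
  have j: "j \<in> carrier K" using i by (simp add: j_def)
  have "h (x \<otimes> (i \<otimes> i)) = (k \<otimes>\<^bsub>K\<^esub> k) \<otimes>\<^bsub>K\<^esub> (j \<otimes>\<^bsub>K\<^esub> j)"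
    using x i eq by (simp add: j_def)
  also have "\<dots> = (j \<otimes>\<^bsub>K\<^esub> k) \<otimes>\<^bsub>K\<^esub> (j \<otimes>\<^bsub>K\<^esub> k)"
    using j k by (simp add: S.m_ac)
  also have "\<dots> = \<one>\<^bsub>K\<^esub>" using pi by (simp add: j_def)
  finally obtain y where y: "y \<in> carrier R" "x \<otimes> (i \<otimes> i) = y \<otimes> y"
    using square_of_hom_one[OF two, of "x \<otimes> (i \<otimes> i)"] x i by auto
  have "x = (x \<otimes> (i \<otimes> i)) \<otimes> (z \<otimes> z)"
  proof -
    have "(x \<otimes> (i \<otimes> i)) \<otimes> (z \<otimes> z) = x \<otimes> ((i \<otimes> z) \<otimes> (i \<otimes> z))" using x i(1) z(1) by algebra
    then show ?thesis using i x by simp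
  qed
  also have "\<dots> = (y \<otimes> z) \<otimes> (y \<otimes> z)" unfolding y(2) using y(1) z(1) by algebra
  finally show ?thesis using y z by auto
qed

lemma card_times_card_le_of_no_solution:
  assumes odd: "odd (card (carrier K))" and fibre: "\<And>k. card {x \<in> carrier R. h x = k} \<le> n"
    and X1: "X1 \<subseteq> Units R" and X2: "X2 \<subseteq> Units R"
    and no: "\<And>x y. x \<in> Units R \<Longrightarrow> y \<in> Units R \<Longrightarrow> x \<oplus> y \<in> X1 \<Longrightarrow> x \<otimes> y \<notin> X2"
  shows "card X1 * card X2 \<le> n\<^sup>2 * card (carrier K)"
proof -
  have finK: "finite (carrier K)" using finite_carrier surj by (metis finite_imageI)
  have "\<one>\<^bsub>K\<^esub> \<oplus>\<^bsub>K\<^esub> \<one>\<^bsub>K\<^esub> \<noteq> \<zero>\<^bsub>K\<^esub>"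
    using S.two_in_Units_of_odd_order[OF finK odd] by (auto simp: K.field_Units)
  then have two: "\<one> \<oplus> \<one> \<in> Units R" using Units_iff[of "\<one> \<oplus> \<one>"] by simp
  obtain d where d: "card (carrier K) = Suc (2 * d)" using odd by (auto elim: oddE)
  define c where "c = inv (\<one> \<oplus> \<one>)"
  have c: "c \<in> carrier R" "c \<otimes> (\<one> \<oplus> \<one>) = \<one>" using two by (auto simp: c_def)
  define four where "four = (\<one> \<oplus> \<one>) \<otimes> (\<one> \<oplus> \<one>)"
  have four: "four \<in> Units R" "four \<in> carrier R" using two by (auto simp: four_def)
  have X1R: "a \<in> carrier R" if "a \<in> X1" for a using that X1 by auto
  have X2R: "b \<in> carrier R" if "b \<in> X2" for b using that X2 by auto
  \<comment> \<open>A square root \<open>z\<close> of the discriminant gives the solutions (a + z)/2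
    and (a - z)/2, with \<open>c\<close> as one half. Both are units because their product is the
    unit \<open>b\<close>.\<close>
  have nonsquare: "z \<otimes> z \<noteq> a \<otimes> a \<ominus> four \<otimes> b" if a: "a \<in> X1" and b: "b \<in> X2" and z: "z \<in> carrier R" for a b z
  proof
    assume eq: "z \<otimes> z = a \<otimes> a \<ominus> four \<otimes> b"
    note R = X1R[OF a] X2R[OF b] z c(1) four(2)
    define x where "x = c \<otimes> (a \<oplus> z)"
    define y where "y = c \<otimes> (a \<ominus> z)"
    have xy: "x \<in> carrier R" "y \<in> carrier R" using R by (auto simp: x_def y_def)
    have "x \<oplus> y = (c \<otimes> (\<one> \<oplus> \<one>)) \<otimes> a" unfolding x_def y_def using R by algebra
    then have sum: "x \<oplus> y = a" using c R by simp
    have "x \<otimes> y = (c \<otimes> c) \<otimes> (a \<otimes> a \<ominus> z \<otimes> z)" unfolding x_def y_def using R by algebra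
    also have "a \<otimes> a \<ominus> z \<otimes> z = four \<otimes> b" unfolding eq using R by algebra
    also have "(c \<otimes> c) \<otimes> (four \<otimes> b) = (c \<otimes> (\<one> \<oplus> \<one>)) \<otimes> (c \<otimes> (\<one> \<oplus> \<one>)) \<otimes> b"
      unfolding four_def using R by algebra
    also have "\<dots> = b" using c R by simp
    finally have prod: "x \<otimes> y = b" .
    have "x \<in> Units R" using R.unit_factor[of x y] prod xy X2 b by auto
    moreover have "y \<in> Units R" using R.unit_factor[of y x] prod xy X2 b by (auto simp: R.m_comm)
    ultimately show False using no sum prod a b by auto
  qed
  define Y where "Y = (\<lambda>a. a \<otimes> a) ` X1"
  define Z where "Z = (\<lambda>b. four \<otimes> b) ` X2"
  have finX: "finite X1" "finite X2" using X1R X2R finite_carrier by (meson finite_subset subsetI)+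
  have YR: "Y \<subseteq> carrier R" and ZR: "Z \<subseteq> carrier R" using X1R X2R four by (auto simp: Y_def Z_def)
  have YZ: "w \<otimes> w \<noteq> y \<ominus> z" if "y \<in> Y" "z \<in> Z" "w \<in> carrier R" for w y z
    using that nonsquare by (auto simp: Y_def Z_def)
  \<comment> \<open>On units, squaring identifies only \<open>x\<close> and its negative.\<close>
  have cardX1: "card X1 \<le> 2 * card Y"
    unfolding Y_def
  proof (rule card_le_fibres[OF finX(1)])
    fix x assume x: "x \<in> X1"
    have "{x' \<in> X1. x' \<otimes> x' = x \<otimes> x} \<subseteq> {x, \<ominus> x}"
    proof
      fix y assume "y \<in> {x' \<in> X1. x' \<otimes> x' = x \<otimes> x}"
      then have "y \<in> carrier R" "x \<otimes> x = y \<otimes> y" using X1R by auto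
      then show "y \<in> {x, \<ominus> x}" using square_eq_imp[OF two, of x y] x X1 by auto
    qed
    then have "card {x' \<in> X1. x' \<otimes> x' = x \<otimes> x} \<le> card {x, \<ominus> x}" by (rule card_mono[rotated]) simp
    also have "\<dots> \<le> 2" by (simp add: card_insert_if)
    finally show "card {x' \<in> X1. x' \<otimes> x' = x \<otimes> x} \<le> 2" .
  qed
  have cardX2: "card X2 = card Z"
    unfolding Z_def using four X2R by (intro card_image[symmetric] inj_onI) auto
  have "4 * (card Y * card Z) \<le> n\<^sup>2 * (4 * d + 1)"
  proof (rule card_times_card_le_of_fibres[where p = "h"])
    show "finite Y" "finite Z" using finX by (simp_all add: Y_def Z_def)
    show "Y \<inter> Z = {}"
    \<comment> \<open>A common element would give the difference 0, which is a square.\<close>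
    proof (rule equals0I)
      fix y assume y: "y \<in> Y \<inter> Z"
      then have "y \<in> carrier R" using YR by auto
      then have "\<zero> \<otimes> \<zero> = y \<ominus> y" by (simp add: R.minus_eq R.r_neg)
      then show False using YZ[of y y \<zero>] y R.zero_closed by blast
    qed
    show "card {y \<in> Y \<union> Z. h y = k} \<le> n" for k
    proof -
      have "card {y \<in> Y \<union> Z. h y = k} \<le> card {x \<in> carrier R. h x = k}"
        using YR ZR finite_carrier by (intro card_mono) auto
      then show ?thesis using fibre[of k] by linarith
    qed
    show "card A * card B \<le> d"
      if A: "A \<subseteq> h ` Y" and B: "B \<subseteq> h ` Z" and AB: "A \<inter> B = {}" for A B
    proof (rule K.card_times_card_le_half_order[OF finK d])
      show "A \<subseteq> carrier K" "B \<subseteq> carrier K"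
        using A B YR ZR surj by blast+
      show "u \<noteq> \<zero>\<^bsub>K\<^esub> \<and> (\<exists>y\<in>carrier K. u = y \<otimes>\<^bsub>K\<^esub> y)" if "u \<in> A" for u
      proof -
        obtain a where a: "a \<in> X1" "u = h (a \<otimes> a)" using \<open>u \<in> A\<close> A by (auto simp: Y_def)
        then have "a \<otimes> a \<in> Units R" using X1 by auto
        then have "u \<noteq> \<zero>\<^bsub>K\<^esub>" using a X1R Units_iff by auto
        moreover have "u = h a \<otimes>\<^bsub>K\<^esub> h a" using a X1R by simp
        ultimately show ?thesis using a X1R by blast
      qed
      show "k \<otimes>\<^bsub>K\<^esub> k \<noteq> u \<ominus>\<^bsub>K\<^esub> v"
        if uv: "u \<in> A" "v \<in> B" and k: "k \<in> carrier K" for u v k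
      proof
        assume eq: "k \<otimes>\<^bsub>K\<^esub> k = u \<ominus>\<^bsub>K\<^esub> v"
        obtain y z where yz: "y \<in> Y" "u = h y" "z \<in> Z" "v = h z"
          using uv A B by blast
        have yzR: "y \<in> carrier R" "z \<in> carrier R" using yz YR ZR by auto
        have diff: "h (y \<ominus> z) = u \<ominus>\<^bsub>K\<^esub> v"
          using yz yzR by (simp add: R.minus_eq S.minus_eq)
        \<comment> \<open>Disjointness makes the residue of the difference nonzero, as
          \<open>square_lift\<close> requires.\<close>
        have "u \<noteq> v" using uv AB by auto
        then have "u \<ominus>\<^bsub>K\<^esub> v \<noteq> \<zero>\<^bsub>K\<^esub>" using yz yzR by simp
        then obtain w where "w \<in> carrier R" "y \<ominus> z = w \<otimes> w"
          using square_lift[OF two _ k, of "y \<ominus> z"] diff eq yzR by auto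
        then show False using YZ[of y z w] yz by auto
      qed
    qed
  qed
  moreover have "card X1 * card X2 \<le> 2 * (card Y * card Z)"
    using cardX1 cardX2 by (simp add: mult_right_mono)
  ultimately have "2 * (card X1 * card X2) \<le> n\<^sup>2 * (4 * d + 1)" by linarith
  \<comment> \<open>With |K| = 2d + 1 this is 4d + 1 \<le> 4d + 2.\<close>
  also have "\<dots> \<le> 2 * (n\<^sup>2 * card (carrier K))" by (simp add: d)
  finally show ?thesis by simp
qed

end

section \<open>The residue field of a finite valuation ring\<close>

context finite_valuation_ring
begin

lemma maximalideal_max_ideal: "maximalideal (max_ideal R) R"
  unfolding max_ideal_def using theI'[OF unique_maximal_ideal] .

interpretation M: maximalideal "max_ideal R" R by (rule maximalideal_max_ideal)

lemma field_residue_field: "field (residue_field R)"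
  unfolding residue_field_def by (rule M.quotient_is_field[OF is_cring])

lemma proj_eq_zero_iff:
  assumes "x \<in> carrier R"
  shows "max_ideal R +> x = \<zero>\<^bsub>residue_field R\<^esub> \<longleftrightarrow> x \<in> max_ideal R"
proof -
  have "max_ideal R +> x = max_ideal R \<longleftrightarrow> x \<in> max_ideal R"
  proof
    assume "max_ideal R +> x = max_ideal R"
    then show "x \<in> max_ideal R" using M.a_rcos_self[OF assms] by (rule subst)
  next
    assume "x \<in> max_ideal R"
    then show "max_ideal R +> x = max_ideal R" by (rule M.a_rcos_const)
  qed
  then show ?thesis unfolding residue_field_def FactRing_def ring.select_convs .
qed

lemma carrier_residue_field: "carrier (residue_field R) = (+>) (max_ideal R) ` carrier R"
  unfolding residue_field_def FactRing_def partial_object.select_convs A_RCOSETS_def' by blast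

lemma order_eq_card_residue_field: "order R = card (carrier (residue_field R)) * card (max_ideal R)"
  unfolding residue_field_def FactRing_def partial_object.select_convs
  by (rule a_lagrange[OF finite_carrier M.additive_subgroup_axioms, symmetric])

text \<open>If \<open>x\<close> lies outside the maximal ideal, comparability of ideals puts the
  maximal ideal inside \<open>PIdl x\<close>, and maximality makes \<open>PIdl x\<close> the whole
  ring.\<close>

lemma Units_iff_notin_max_ideal:
  assumes x: "x \<in> carrier R"
  shows "x \<in> Units R \<longleftrightarrow> x \<notin> max_ideal R"
proof
  assume u: "x \<in> Units R"
  show "x \<notin> max_ideal R"
  proof
    assume "x \<in> max_ideal R"
    then have "inv x \<otimes> x \<in> max_ideal R" using u by (intro M.I_l_closed) auto
    then show False using u M.one_imp_carrier M.I_notcarr by auto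
  qed
next
  assume nx: "x \<notin> max_ideal R"
  have I: "ideal (PIdl x) R" using x by (rule cgenideal_ideal)
  have "\<not> PIdl x \<subseteq> max_ideal R" using nx cgenideal_self[OF x] by auto
  then have "max_ideal R \<subseteq> PIdl x" using ideals_total[OF I M.is_ideal] by auto
  moreover have "PIdl x \<subseteq> carrier R" using I by (simp add: ideal.Icarr subsetI)
  ultimately have "PIdl x = carrier R" using M.I_maximal[OF I] nx cgenideal_self[OF x] by auto
  then obtain y where "y \<in> carrier R" "\<one> = y \<otimes> x" unfolding cgenideal_def using one_closed by blast
  then show "x \<in> Units R" using x unfolding Units_def by (auto intro!: bexI[of _ y] simp: m_comm)
qed

text \<open>A nonempty fibre over \<open>k\<close> is contained in the coset \<open>k\<close>
  itself, and all cosets have the size of the ideal. For any other \<open>k\<close> the fibre is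
  empty.\<close>

lemma card_proj_fibre_le: "card {x \<in> carrier R. max_ideal R +> x = k} \<le> card (max_ideal R)"
proof (cases "\<exists>x\<in>carrier R. max_ideal R +> x = k")
  case True
  then obtain x where x: "x \<in> carrier R" "k = max_ideal R +> x" by auto
  have k: "k \<in> a_rcosets (max_ideal R)" using x M.a_subset by (simp add: a_rcosetsI)
  have fk: "finite k" using k x a_r_coset_subset_G[OF M.a_subset x(1)] finite_carrier finite_subset by auto
  have "{x \<in> carrier R. max_ideal R +> x = k} \<subseteq> k" using M.a_rcos_self by auto
  then have "card {x \<in> carrier R. max_ideal R +> x = k} \<le> card k" using fk by (rule card_mono[rotated])
  also have "\<dots> = card (max_ideal R)"
    using a_card_cosets_equal[OF k M.a_subset finite_carrier] by simp
  finally show ?thesis .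
next
  case False
  then have "{x \<in> carrier R. max_ideal R +> x = k} = {}" by blast
  then show ?thesis by (simp only: card.empty le0)
qed

lemma unit_reflecting_hom_residue_field:
  "unit_reflecting_hom R (residue_field R) ((+>) (max_ideal R))"
proof (intro unit_reflecting_hom.intro unit_reflecting_hom_axioms.intro)
  show "ring_hom_cring R (residue_field R) ((+>) (max_ideal R))"
    unfolding residue_field_def by (rule M.rcos_ring_hom_cring[OF is_cring])
qed (use field_residue_field finite_carrier carrier_residue_field Units_iff_notin_max_ideal proj_eq_zero_iff in auto)

end

section \<open>Comparison of the fibre bound with the stated threshold\<close>

theorem theorem1p7:
  fixes R :: "('a, 'b) ring_scheme" (structure) and q r :: nat and X1 X2 :: "'a set"
  assumes "finite_valuation_ring R"
    and "card (carrier (residue_field R)) = q"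
    and "primepow q" and "odd q"
    and "order R = q ^ r"
    and "X1 \<subseteq> Units R" and "X2 \<subseteq> Units R"
    and "real (card X1) * real (card X2)
           > real q ^ (4 * r - 1) / (real q ^ r - real q ^ (r - 1))\<^sup>2"
  shows "\<exists>x \<in> Units R. \<exists>y \<in> Units R. x \<oplus> y \<in> X1 \<and> x \<otimes> y \<in> X2"
proof (rule ccontr)
  interpret finite_valuation_ring R by fact
  assume "\<not> ?thesis"
  then have no: "x \<otimes> y \<notin> X2" if "x \<in> Units R" "y \<in> Units R" "x \<oplus> y \<in> X1" for x y
    using that by blast
  define s where "s = card (max_ideal R)"
  have q: "q > 1" using \<open>primepow q\<close> primepow_gt_Suc_0 by simp
  have qs: "q * s = q ^ r"
    using order_eq_card_residue_field assms(2,5) by (simp add: s_def)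
  \<comment> \<open>For r = 0 the relation would read q * s = 1; positivity makes the truncated
    \<open>r - 1\<close> an honest predecessor.\<close>
  have "r > 0" using qs q by (cases r) auto
  then obtain k where k: "r = Suc k" by (cases r) auto
  have s: "s = q ^ k" using qs q by (simp add: k)
  have "card X1 * card X2 \<le> s\<^sup>2 * q"
    using unit_reflecting_hom.card_times_card_le_of_no_solution
      [OF unit_reflecting_hom_residue_field _ card_proj_fibre_le assms(6,7) no] assms(2,4)
    by (simp add: s_def)
  then have "real (card X1) * real (card X2) \<le> (real s)\<^sup>2 * real q"
    by (metis of_nat_le_iff of_nat_mult of_nat_power)
  \<comment> \<open>The stated threshold equals s^2 q times (q / (q - 1))^2, and this last factor is
    at least 1.\<close>
  also have "\<dots> \<le> (real s)\<^sup>2 * real q * ((real q)\<^sup>2 / (real q - 1)\<^sup>2)"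
  proof -
    have "1 \<le> (real q)\<^sup>2 / (real q - 1)\<^sup>2" using q by (simp add: power_mono)
    then show ?thesis using mult_left_mono[of 1 "(real q)\<^sup>2 / (real q - 1)\<^sup>2" "(real s)\<^sup>2 * real q"] by simp
  qed
  also have "\<dots> = real q ^ (4 * r - 1) / (real q ^ r - real q ^ (r - 1))\<^sup>2"
  proof -
    have "4 * r - 1 = 4 * k + 3" by (simp add: k)
    then have e1: "real q ^ (4 * r - 1) = (real s)\<^sup>2 * (real s)\<^sup>2 * (real q * (real q)\<^sup>2)"
      by (simp add: s power_mult[symmetric] power_add[symmetric] flip: power_Suc)
    have e2: "real q ^ r - real q ^ (r - 1) = real s * (real q - 1)"
      by (simp add: k s algebra_simps)
    have "real s > 0" using q by (simp add: s)
    then show ?thesis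
      unfolding e1 e2 power_mult_distrib by (simp add: power2_eq_square)
  qed
  finally show False using assms(8) by simp
qed

end
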